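(* Let $T\colon X\to X$ be a continuous transformation of a nonempty compact metric space, let $(f_n)_{n\ge1}$ be a subadditive sequence of upper semi-continuous functions $f_n\colon X\to\mathbb{R}\cup \{-\infty\}$, and define $\tilde \beta[(f_n)]:=\lim_{n \to \infty} \sup_{x \in X}\frac{1}{n}f_n(x)$. Then there exists $z \in X$ such that $\inf_{m \geq 1}\frac{1}{m}f_m(z) \geq \tilde\beta[(f_n)]$.
   Context: A sequence $(f_n)_{n\ge1}$ of functions from $X$ to $\mathbb{R}\cup\{-\infty\}$ is subadditive if $f_{n+m}(x)\le f_n(T^mx)+f_m(x)$ for all $x\in X$ and $n,m\ge1$. The limit defining $\tilde\beta[(f_n)]\in\mathbb{R}\cup\{-\infty\}$ exists by Fekete's subadditivity lemma. *)

theory Defs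
  imports "HOL-Analysis.Analysis"
begin

definition upper_semicontinuous_on :: "'a::topological_space set \<Rightarrow> ('a \<Rightarrow> ereal) \<Rightarrow> bool" where
  "upper_semicontinuous_on X g \<longleftrightarrow> (\<forall>c. openin (top_of_set X) {x \<in> X. g x < c})"

text \<open>
  Sequences are indexed from 1; the value at index 0 is never constrained.
\<close>

definition subadditive_sequence_on :: "'a set \<Rightarrow> ('a \<Rightarrow> 'a) \<Rightarrow> (nat \<Rightarrow> 'a \<Rightarrow> ereal) \<Rightarrow> bool" where
  "subadditive_sequence_on X T f \<longleftrightarrow>
     (\<forall>n\<ge>1. \<forall>m\<ge>1. \<forall>x\<in>X. f (n + m) x \<le> f n ((T ^^ m) x) + f m x)"

text \<open>
  For a subadditive sequence of upper semicontinuous functions with values below \<open>\<infinity>\<close> on a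
  nonempty compact space, the limit exists by Fekete's lemma.
\<close>

definition beta_tilde :: "'a set \<Rightarrow> (nat \<Rightarrow> 'a \<Rightarrow> ereal) \<Rightarrow> ereal" where
  "beta_tilde X f = lim (\<lambda>n. SUP x\<in>X. ereal (1 / real n) * f n x)"

end

theory Submission
  imports Defs
begin

text \<open>
  If every orbit segment can be started with a block of length \<open>m \<le> N\<close> on which \<open>f m \<le> m c\<close>,
  cutting the orbit greedily into such blocks gives \<open>f n \<le> n c + C\<close> uniformly. With blocks
  of constant length this is Fekete's lemma. It also shows that for \<open>c < \<beta>\<close> and every \<open>N\<close> some
  point \<open>z\<close> satisfies \<open>f m z > m c\<close> for all \<open>1 \<le> m \<le> N\<close>; as the superlevel sets are closed,
  the finite intersection property yields a point that works for all \<open>c < \<beta>\<close> and all \<open>m\<close>.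
\<close>

text \<open>The complement within \<open>X\<close> is relatively open by semicontinuity. Compactness
  of \<open>X\<close> upgrades relatively closed to closed in the whole space, the form that
  \<open>compact_imp_fip_image\<close> asks for.\<close>

lemma upper_semicontinuous_on_closed_superlevel:
  fixes X :: "'a::t2_space set"
  assumes "compact X" "upper_semicontinuous_on X g"
  shows "closed {x\<in>X. c \<le> g x}"
proof -
  have "X - {x\<in>X. c \<le> g x} = {x\<in>X. g x < c}" by auto
  then have "closedin (top_of_set X) {x\<in>X. c \<le> g x}"
    using assms(2) by (auto simp: closedin_def upper_semicontinuous_on_def)
  then show ?thesis
    using assms(1) closedin_compact compact_imp_closed by blast
qed

text \<open>If \<open>g\<close> were unbounded above, the nested closed sets where \<open>g\<close>
  is at least \<open>n\<close> would all be nonempty, and a common point would have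
  \<open>g x = \<infinity>\<close>.\<close>

lemma upper_semicontinuous_on_bounded_above:
  fixes X :: "'a::t2_space set"
  assumes "compact X" "upper_semicontinuous_on X g" and fin: "\<And>x. x \<in> X \<Longrightarrow> g x \<noteq> \<infinity>"
  shows "\<exists>B::real. \<forall>x\<in>X. g x \<le> ereal B"
proof (rule ccontr)
  assume unbounded: "\<not> ?thesis"
  have "X \<inter> (\<Inter>n\<in>(UNIV::nat set). {x\<in>X. ereal (real n) \<le> g x}) \<noteq> {}"
  proof (rule compact_imp_fip_image[OF assms(1)])
    show "closed {x\<in>X. ereal (real n) \<le> g x}" for n
      by (rule upper_semicontinuous_on_closed_superlevel[OF assms(1,2)])
  next
    fix I :: "nat set"
    assume "finite I"
    then obtain N where N: "\<And>n. n \<in> I \<Longrightarrow> n \<le> N"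
      using finite_nat_set_iff_bounded_le by auto
    obtain x where "x \<in> X" "ereal (real N) < g x"
      using unbounded by (meson not_le)
    moreover have "ereal (real n) \<le> g x" if "n \<in> I" for n
      using N[OF that] \<open>ereal (real N) < g x\<close>
      by (meson ereal_less_eq(3) le_less_trans less_imp_le of_nat_mono)
    ultimately show "X \<inter> (\<Inter>n\<in>I. {x\<in>X. ereal (real n) \<le> g x}) \<noteq> {}"
      by auto
  qed
  then obtain x where x: "x \<in> X" "\<And>n::nat. ereal (real n) \<le> g x" by auto
  have "g x = \<infinity>"
  proof (rule ereal_top)
    fix B :: real
    obtain n :: nat where "B \<le> real n" using real_arch_simple by blast
    then show "ereal B \<le> g x" using x(2) by (meson ereal_less_eq(3) order_trans)
  qed
  with fin x(1) show False by blast
qed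

lemma funpow_image_subset:
  assumes "T ` X \<subseteq> X" "x \<in> X"
  shows "(T ^^ n) x \<in> X"
  using assms by (induction n) auto

lemma subadditive_sequence_on_block_bound:
  fixes c :: real
  assumes sub: "subadditive_sequence_on X T f" and T: "T ` X \<subseteq> X"
    and bdd: "\<And>n. n \<ge> 1 \<Longrightarrow> \<exists>B::real. \<forall>x\<in>X. f n x \<le> ereal B"
    and block: "\<And>x. x \<in> X \<Longrightarrow> \<exists>m\<in>{1..N}. f m x \<le> ereal (real m * c)"
  shows "\<exists>C::real. \<forall>n\<ge>1. \<forall>x\<in>X. f n x \<le> ereal (real n * c + C)"
proof -
  obtain B :: "nat \<Rightarrow> real" where B: "\<And>n x. n \<ge> 1 \<Longrightarrow> x \<in> X \<Longrightarrow> f n x \<le> ereal (B n)"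
    using bdd by metis
  \<comment> \<open>The error is paid only once, on the final piece of length at most
    \<open>N\<close>: each block cut off before it costs at most \<open>m * c\<close>. Summing over
    all possible final lengths makes \<open>C\<close> independent of \<open>n\<close> and
    \<open>x\<close>.\<close>
  define C where "C = (\<Sum>n\<in>{1..N}. \<bar>B n - real n * c\<bar>)"
  have "f n x \<le> ereal (real n * c + C)" if "n \<ge> 1" "x \<in> X" for n x
    using that
  proof (induction n arbitrary: x rule: less_induct)
    case (less n)
    show ?case
    proof (cases "n \<le> N")
      case True
      then have "\<bar>B n - real n * c\<bar> \<le> C"
        unfolding C_def using less.prems(1) by (intro member_le_sum) auto
      then have "B n \<le> real n * c + C" by linarith
      then show ?thesis using B[OF less.prems] by (meson ereal_less_eq(3) order_trans)
    next
      case False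
      obtain m where m: "m \<ge> 1" "m \<le> N" "f m x \<le> ereal (real m * c)"
        using block[OF less.prems(2)] by auto
      \<comment> \<open>Since \<open>m \<le> N < n\<close>, the remainder never has length 0, where
        \<open>f\<close> is unconstrained.\<close>
      have "n - m \<ge> 1" using m False by simp
      have "f n x = f ((n - m) + m) x" using m False by simp
      also have "\<dots> \<le> f (n - m) ((T ^^ m) x) + f m x"
        using sub \<open>n - m \<ge> 1\<close> m(1) less.prems(2) unfolding subadditive_sequence_on_def by blast
      also have "\<dots> \<le> ereal (real (n - m) * c + C) + ereal (real m * c)"
        using \<open>n - m \<ge> 1\<close> m less.prems(2) funpow_image_subset[OF T less.prems(2)]
        by (intro add_mono less.IH) simp_all
      also have "\<dots> = ereal (real n * c + C)"
        using m False by (simp add: of_nat_diff algebra_simps)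
      finally show ?thesis .
    qed
  qed
  then show ?thesis by blast
qed

lemma inverse_mult_le_ereal_iff:
  assumes "n \<ge> 1"
  shows "ereal (1 / real n) * y \<le> ereal c \<longleftrightarrow> y \<le> ereal (real n * c)"
  using assms by (cases y) (auto simp: field_simps)

lemma le_inverse_mult_ereal_iff:
  assumes "n \<ge> 1"
  shows "ereal c \<le> ereal (1 / real n) * y \<longleftrightarrow> ereal (real n * c) \<le> y"
  using assms by (cases y) (auto simp: field_simps)

text \<open>Dividing the block bound by \<open>n\<close> turns the constant into
  \<open>C / n\<close>, which vanishes in the limit. The contrapositive produces, for
  \<open>c\<close> below the limsup, a point violating the block condition at every length up to
  \<open>N\<close>.\<close>

lemma subadditive_sequence_on_limsup_le:
  fixes c :: real
  assumes sub: "subadditive_sequence_on X T f" and T: "T ` X \<subseteq> X"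
    and bdd: "\<And>n. n \<ge> 1 \<Longrightarrow> \<exists>B::real. \<forall>x\<in>X. f n x \<le> ereal B"
    and block: "\<And>x. x \<in> X \<Longrightarrow> \<exists>m\<in>{1..N}. f m x \<le> ereal (real m * c)"
  shows "limsup (\<lambda>n. SUP x\<in>X. ereal (1 / real n) * f n x) \<le> ereal c"
proof -
  obtain C :: real where C: "\<And>n x. n \<ge> 1 \<Longrightarrow> x \<in> X \<Longrightarrow> f n x \<le> ereal (real n * c + C)"
    using subadditive_sequence_on_block_bound[OF assms] by blast
  have "(SUP x\<in>X. ereal (1 / real n) * f n x) \<le> ereal (c + C / real n)" if "n \<ge> 1" for n
  proof (rule SUP_least)
    fix x assume "x \<in> X"
    have "real n * (c + C / real n) = real n * c + C"
      using that by (simp add: field_simps)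
    then show "ereal (1 / real n) * f n x \<le> ereal (c + C / real n)"
      using C[OF that \<open>x \<in> X\<close>] inverse_mult_le_ereal_iff[OF that] by simp
  qed
  then have "limsup (\<lambda>n. SUP x\<in>X. ereal (1 / real n) * f n x) \<le> limsup (\<lambda>n. ereal (c + C / real n))"
    by (intro Limsup_mono) (auto simp: eventually_at_top_linorder)
  also have "(\<lambda>n. c + C / real n) \<longlonglongrightarrow> c"
    using tendsto_add[OF tendsto_const lim_const_over_n, of c C] by simp
  then have "limsup (\<lambda>n. ereal (c + C / real n)) = ereal c"
    by (intro lim_imp_Limsup) auto
  finally show ?thesis .
qed

text \<open>This is Fekete's lemma: \<open>lim\<close> is informative only once convergence is
  known, and that follows from bounding the limsup by every term \<open>b m\<close> with
  \<open>m \<ge> 1\<close>, hence by the liminf.\<close>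

lemma beta_tilde_eq_limsup:
  assumes sub: "subadditive_sequence_on X T f" and T: "T ` X \<subseteq> X"
    and bdd: "\<And>n. n \<ge> 1 \<Longrightarrow> \<exists>B::real. \<forall>x\<in>X. f n x \<le> ereal B"
  shows "beta_tilde X f = limsup (\<lambda>n. SUP x\<in>X. ereal (1 / real n) * f n x)"
proof -
  define b where "b n = (SUP x\<in>X. ereal (1 / real n) * f n x)" for n
  have "limsup b \<le> b m" if m: "m \<ge> 1" for m
  proof (rule ereal_le_real)
    \<comment> \<open>Testing against real upper bounds \<open>c\<close> covers the case
      \<open>b m = -\<infinity>\<close>.\<close>
    fix c :: real assume c: "b m \<le> ereal c"
    have "f m x \<le> ereal (real m * c)" if "x \<in> X" for x
    proof -
      have "ereal (1 / real m) * f m x \<le> b m"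
        unfolding b_def using that by (rule SUP_upper)
      then show ?thesis using c inverse_mult_le_ereal_iff[OF m] order_trans by blast
    qed
    then have block: "\<exists>k\<in>{1..m}. f k x \<le> ereal (real k * c)" if "x \<in> X" for x
      using m that by (intro bexI[of _ m]) auto
    show "limsup b \<le> ereal c"
      unfolding b_def by (rule subadditive_sequence_on_limsup_le[OF sub T bdd block])
  qed
  then have "limsup b \<le> liminf b"
    by (intro Liminf_bounded) (auto simp: eventually_at_top_linorder)
  then have "b \<longlonglongrightarrow> limsup b"
    using Liminf_le_Limsup[of sequentially b]
    by (intro Liminf_eq_Limsup) auto
  then show ?thesis
    unfolding beta_tilde_def b_def by (rule limI)
qed

theorem propositionA7:
  fixes X :: "'a::metric_space set"
    and T :: "'a \<Rightarrow> 'a"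
    and f :: "nat \<Rightarrow> 'a \<Rightarrow> ereal"
  assumes "compact X" and "X \<noteq> {}"
    and "continuous_on X T" and "T ` X \<subseteq> X"
    and "\<And>n x. n \<ge> 1 \<Longrightarrow> x \<in> X \<Longrightarrow> f n x \<noteq> \<infinity>"
    and "\<And>n. n \<ge> 1 \<Longrightarrow> upper_semicontinuous_on X (f n)"
    and "subadditive_sequence_on X T f"
  shows "\<exists>z\<in>X. (INF m\<in>{1..}. ereal (1 / real m) * f m z) \<ge> beta_tilde X f"
proof -
  have bdd: "\<exists>B::real. \<forall>x\<in>X. f n x \<le> ereal B" if "n \<ge> 1" for n
    using upper_semicontinuous_on_bounded_above assms(1,5,6) that by blast
  let ?\<beta> = "beta_tilde X f"
  let ?K = "\<lambda>(c, m). {z\<in>X. ereal (real m * c) \<le> f m z}"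
  \<comment> \<open>Only real \<open>c\<close> strictly below the limit are used. If the limit is
    \<open>-\<infinity>\<close>, the family is empty and any point of \<open>X\<close> will
    do.\<close>
  let ?I = "{(c, m :: nat). ereal c < ?\<beta> \<and> 1 \<le> m}"
  have "X \<inter> (\<Inter>i\<in>?I. ?K i) \<noteq> {}"
  proof (rule compact_imp_fip_image[OF assms(1)])
    fix i :: "real \<times> nat"
    assume "i \<in> ?I"
    then obtain c m where "i = (c, m)" "1 \<le> m" by blast
    then show "closed (?K i)"
      using upper_semicontinuous_on_closed_superlevel[OF assms(1) assms(6)[OF \<open>1 \<le> m\<close>]] by simp
  next
    fix J :: "(real \<times> nat) set"
    assume J: "finite J" "J \<subseteq> ?I"
    show "X \<inter> (\<Inter>i\<in>J. ?K i) \<noteq> {}"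
    proof (cases "J = {}")
      case True
      then show ?thesis using assms(2) by simp
    next
      case False
      \<comment> \<open>One point for the largest level and the largest length meets all conditions
        in \<open>J\<close>. The maximum is attained in \<open>J\<close>, so it still lies strictly
        below the limit.\<close>
      define c where "c = Max (fst ` J)"
      define N where "N = Max (snd ` J)"
      have "c \<in> fst ` J" unfolding c_def using J(1) False by (intro Max_in) auto
      then have "ereal c < ?\<beta>" using J(2) by auto
      then have "\<not> limsup (\<lambda>n. SUP x\<in>X. ereal (1 / real n) * f n x) \<le> ereal c"
        using beta_tilde_eq_limsup[OF assms(7,4) bdd] by simp
      then obtain z where z: "z \<in> X" "\<And>m. m \<in> {1..N} \<Longrightarrow> ereal (real m * c) < f m z"
        using subadditive_sequence_on_limsup_le[OF assms(7,4) bdd] by (meson not_le)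
      have "ereal (real m * d) \<le> f m z" if i: "(d, m) \<in> J" for d m
      proof -
        have "d \<le> c" unfolding c_def using J(1) i by (intro Max_ge) (auto intro: rev_image_eqI)
        moreover have "m \<le> N" unfolding N_def using J(1) i by (intro Max_ge) (auto intro: rev_image_eqI)
        moreover have "1 \<le> m" using J(2) i by auto
        ultimately have "ereal (real m * d) \<le> ereal (real m * c)" "ereal (real m * c) < f m z"
          using z(2) by (auto intro: mult_left_mono)
        then show ?thesis by order
      qed
      then show ?thesis using z(1) by auto
    qed
  qed
  then obtain z where z: "z \<in> X" and K: "z \<in> (\<Inter>i\<in>?I. ?K i)"
    by blast
  have ge: "ereal (real m * c) \<le> f m z" if "ereal c < ?\<beta>" "1 \<le> m" for c m
    using INT_D[OF K, of "(c, m)"] that by simp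
  have "?\<beta> \<le> ereal (1 / real m) * f m z" if m: "1 \<le> m" for m
  proof (rule ccontr)
    assume "\<not> ?thesis"
    then have "ereal (1 / real m) * f m z < ?\<beta>" by (rule not_le_imp_less)
    \<comment> \<open>Density supplies a real level strictly between, even if
      \<open>f m z = -\<infinity>\<close>; membership of \<open>z\<close> in the set for
      \<open>(c, m)\<close> then gives the contradiction.\<close>
    then obtain c where c: "ereal (1 / real m) * f m z < ereal c" "ereal c < ?\<beta>"
      using ereal_dense2 by blast
    have "ereal c \<le> ereal (1 / real m) * f m z"
      using ge[OF c(2) m] le_inverse_mult_ereal_iff[OF m] by blast
    with c(1) show False by order
  qed
  then show ?thesis using z by (auto intro: INF_greatest)
qed

end
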